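(* The ternary quintic $F = xyz^3 + y^4 z \in \mathbb{C}[x,y,z]$ has Waring rank $r(F)=10$. In particular, there exists a form of degree $5$ in $3$ variables of Waring rank $10$.
   Context: The Waring rank $r(F)$ of a homogeneous form $F$ of degree $d$ is the least $r$ such that $F=\sum_{i=1}^r c_i\ell_i^d$ for some linear forms $\ell_i$ and scalars $c_i\in\mathbb{C}$. *)

theory Defs
  imports Complex_Main
begin

text \<open>Forms in three variables over the complex numbers are represented by their
polynomial functions on complex^3 (over an infinite field a polynomial is determined
by its function). A linear form is given by its coefficient triple (a,b,c), i.e.
the function (x,y,z) maps to a*x + b*y + c*z.\<close>

definition lin_form :: "complex \<times> complex \<times> complex \<Rightarrow> complex \<Rightarrow> complex \<Rightarrow> complex \<Rightarrow> complex" where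
  "lin_form l x y z = fst l * x + fst (snd l) * y + snd (snd l) * z"

definition waring_decomposable ::
  "nat \<Rightarrow> (complex \<Rightarrow> complex \<Rightarrow> complex \<Rightarrow> complex) \<Rightarrow> nat \<Rightarrow> bool" where
  "waring_decomposable d F r \<longleftrightarrow>
     (\<exists>(c :: nat \<Rightarrow> complex) (l :: nat \<Rightarrow> complex \<times> complex \<times> complex).
        \<forall>x y z. F x y z = (\<Sum>i<r. c i * (lin_form (l i) x y z) ^ d))"

definition waring_rank :: "nat \<Rightarrow> (complex \<Rightarrow> complex \<Rightarrow> complex \<Rightarrow> complex) \<Rightarrow> nat" where
  "waring_rank d F = (LEAST r. waring_decomposable d F r)"

end

theory Submission
  imports Defs
begin

text \<open>
  Expanding fifth powers, a decomposition of \<open>F = x y z^3 + y^4 z\<close> into \<open>r\<close> powers is a weighted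
  configuration of \<open>r\<close> points \<open>(a, b, c)\<close> whose moments of degree 5 are, up to scaling by 20,
  1 on \<open>a b c^3\<close>, 4 on \<open>b^4 c\<close> and 0 on all other monomials.  Let \<open>A\<close> be the points with \<open>a \<noteq> 0\<close>, with
  affine coordinates \<open>u = b/a\<close>, \<open>v = c/a\<close>.  On \<open>A\<close> every moment of degree at most 4 vanishes except
  that of \<open>u v^3\<close>.  Multiplying a polynomial that vanishes on \<open>A\<close> by monomials and taking moments
  kills its coefficients from the top degree downwards; in this way the 8 monomials \<open>u^p v^q\<close> with
  \<open>p \<le> 1\<close>, \<open>q \<le> 3\<close> are independent on \<open>A\<close>, so \<open>A\<close> has at least 8 points.  The degree 5 moments
  show that \<open>u^2\<close> may be added to the list if there is at most one point outside \<open>A\<close>, and \<open>u^2 v\<close> as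
  well if there is none.  Hence \<open>r \<le> 9\<close> is impossible.

  For the upper bound, \<open>((y + z)^5 - (y - z)^5)/10 = y^4 z + 2 y^2 z^3 + z^5/5\<close>, and the rest of \<open>F\<close> is
  \<open>(P^2 z^3/4 - z^5/10) - (N^2 z^3/4 + z^5/10)\<close> with \<open>P = x - y\<close> and \<open>N = x - 3 y\<close>, two binary
  quintics of rank 4.
\<close>

section \<open>Linear relations on a finite point set\<close>

lemma exists_nontrivial_vanishing_combination:
  fixes f :: "'j \<Rightarrow> 'i \<Rightarrow> 'a::field"
  assumes "finite A" "finite J" "card A < card J"
  shows "\<exists>c. (\<forall>j. j \<notin> J \<longrightarrow> c j = 0) \<and> (\<exists>j. c j \<noteq> 0) \<and> (\<forall>i\<in>A. (\<Sum>j\<in>J. c j * f j i) = 0)"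
  using assms
proof (induction A arbitrary: J f rule: finite_induct)
  case empty
  then obtain j where "j \<in> J" by fastforce
  then show ?case by (intro exI[of _ "\<lambda>k. if k = j then 1 else 0"]) auto
next
  case (insert a A)
  show ?case
  proof (cases "\<forall>j\<in>J. f j a = 0")
    case True
    have "card A < card J" using insert by simp
    from insert.IH[OF insert.prems(1) this, of f] True show ?thesis by auto
  next
    case False
    then obtain k where k: "k \<in> J" "f k a \<noteq> 0" by auto
    \<comment> \<open>Gaussian elimination with pivot \<open>k\<close>: every \<open>g j\<close>
      vanishes at \<open>a\<close>, so a relation among the \<open>g j\<close> on \<open>A\<close>
      becomes one among the \<open>f j\<close> on \<open>insert a A\<close> once \<open>f k\<close>
      receives the coefficient \<open>- s\<close>.\<close>
    define g where "g j i = f j i - f j a / f k a * f k i" for j i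
    have "card A < card (J - {k})" using insert k by simp
    from insert.IH[OF _ this, of g] insert.prems(1) obtain c where
      c: "\<And>j. j \<notin> J - {k} \<Longrightarrow> c j = 0" "\<exists>j. c j \<noteq> 0"
        "\<And>i. i \<in> A \<Longrightarrow> (\<Sum>j\<in>J - {k}. c j * g j i) = 0" by auto
    define s where "s = (\<Sum>j\<in>J - {k}. c j * (f j a / f k a))"
    define c' where "c' = c(k := - s)"
    have eq: "(\<Sum>j\<in>J. c' j * f j i) = (\<Sum>j\<in>J - {k}. c j * g j i)" for i
    proof -
      have "(\<Sum>j\<in>J. c' j * f j i) = - s * f k i + (\<Sum>j\<in>J - {k}. c j * f j i)"
        using k insert.prems(1) by (subst sum.remove[of _ k]) (auto simp: c'_def)
      also have "\<dots> = (\<Sum>j\<in>J - {k}. c j * g j i)"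
        by (simp add: s_def g_def algebra_simps sum_subtractf sum_distrib_left)
      finally show ?thesis .
    qed
    have "g j a = 0" for j using k by (simp add: g_def)
    then have "\<forall>i\<in>insert a A. (\<Sum>j\<in>J. c' j * f j i) = 0"
      using c(3) by (simp add: eq)
    moreover have "\<forall>j. j \<notin> J \<longrightarrow> c' j = 0" using c(1) k by (auto simp: c'_def)
    moreover have "\<exists>j. c' j \<noteq> 0"
      using c(1)[of k] c(2) by (auto simp: c'_def)
    ultimately show ?thesis by blast
  qed
qed

section \<open>Independence of monomials from their moments\<close>

lemma moment_vanishing_combination:
  fixes w u v :: "'i \<Rightarrow> complex" and c :: "nat \<times> nat \<Rightarrow> complex"
  assumes "\<And>i. i \<in> A \<Longrightarrow> (\<Sum>(p, q)\<in>J. c (p, q) * (u i ^ p * v i ^ q)) = 0"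
  shows "(\<Sum>(p, q)\<in>J. c (p, q) * (\<Sum>i\<in>A. w i * u i ^ (p + s) * v i ^ (q + t))) = 0"
proof -
  have "(\<Sum>(p, q)\<in>J. c (p, q) * (\<Sum>i\<in>A. w i * u i ^ (p + s) * v i ^ (q + t)))
      = (\<Sum>i\<in>A. \<Sum>(p, q)\<in>J. c (p, q) * (w i * u i ^ (p + s) * v i ^ (q + t)))"
    by (subst sum.swap) (simp add: case_prod_unfold sum_distrib_left)
  also have "\<dots> = (\<Sum>i\<in>A. w i * u i ^ s * v i ^ t * (\<Sum>(p, q)\<in>J. c (p, q) * (u i ^ p * v i ^ q)))"
    by (simp add: sum_distrib_left case_prod_unfold power_add mult_ac)
  also have "\<dots> = 0" using assms by simp
  finally show ?thesis .
qed

text \<open>The monomials outside the ideal \<open>(u^2, v^4)\<close>, which is the apolar ideal of \<open>\<partial>F/\<partial>x = y z^3\<close>.\<close>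

definition low_exponents :: "(nat \<times> nat) set" where
  "low_exponents = {(0,0), (1,0), (0,1), (1,1), (0,2), (1,2), (0,3), (1,3)}"

lemma low_combination_trivial:
  fixes w u v :: "'i \<Rightarrow> complex" and c :: "nat \<times> nat \<Rightarrow> complex"
  assumes M: "\<And>p q. p + q \<le> 4 \<Longrightarrow>
      (\<Sum>i\<in>A. w i * u i ^ p * v i ^ q) = (if p = 1 \<and> q = 3 then 1 else 0)"
    and van: "\<And>i. i \<in> A \<Longrightarrow> (\<Sum>(p, q)\<in>low_exponents. c (p, q) * (u i ^ p * v i ^ q)) = 0"
    and j: "j \<in> low_exponents"
  shows "c j = 0"
proof -
  define m where "m p q = (\<Sum>i\<in>A. w i * u i ^ p * v i ^ q)" for p q
  have D: "(\<Sum>(p, q)\<in>low_exponents. c (p, q) * m (p + s) (q + t)) = 0" for s t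
    unfolding m_def by (rule moment_vanishing_combination) (rule van)
  have m: "m p q = (if p = 1 \<and> q = 3 then 1 else 0)" if "p + q \<le> 4" for p q
    using M[OF that] by (simp add: m_def)
  \<comment> \<open>To isolate \<open>c (p, q)\<close>, multiply by u^(1-p) v^(3-q): its monomial
    becomes u v^3, the only one of degree at most 4 with nonzero moment. In the order chosen, each
    product of degree above 4 carries a coefficient already known to vanish.\<close>
  have c13: "c (Suc 0, 3) = 0" using D[of 0 0] by (simp add: low_exponents_def m)
  have c12: "c (Suc 0, 2) = 0" using D[of 0 1] by (simp add: low_exponents_def m c13)
  have c03: "c (0, 3) = 0" using D[of 1 0] by (simp add: low_exponents_def m c13 c12)
  have c11: "c (Suc 0, Suc 0) = 0" using D[of 0 2] by (simp add: low_exponents_def m c13 c12 c03)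
  have c02: "c (0, 2) = 0" using D[of 1 1] by (simp add: low_exponents_def m c13 c12 c03 c11)
  have c10: "c (Suc 0, 0) = 0" using D[of 0 3] by (simp add: low_exponents_def m c13 c12 c03 c11 c02)
  have c01: "c (0, Suc 0) = 0" using D[of 1 2] by (simp add: low_exponents_def m c13 c12 c03 c11 c02 c10)
  have c00: "c (0, 0) = 0" using D[of 1 3] by (simp add: low_exponents_def m c13 c12 c03 c11 c02 c10 c01)
  show ?thesis using j c13 c12 c03 c11 c02 c10 c01 c00 by (auto simp: low_exponents_def)
qed

text \<open>The term \<open>k * y ^ p * z ^ q\<close> is the contribution of a single point (0, y,
  z) outside \<open>A\<close>; \<open>k = 0\<close> covers the case of no such point. Only then may
  u^2 v take part, and \<open>or\<close> expresses this, so that one statement serves both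
  cases.\<close>

lemma combination_trivial:
  fixes w u v :: "'i \<Rightarrow> complex" and c :: "nat \<times> nat \<Rightarrow> complex"
  assumes M: "\<And>p q. p + q \<le> 4 \<Longrightarrow>
      (\<Sum>i\<in>A. w i * u i ^ p * v i ^ q) = (if p = 1 \<and> q = 3 then 1 else 0)"
    and M5: "\<And>p q. p + q = 5 \<Longrightarrow>
      (\<Sum>i\<in>A. w i * u i ^ p * v i ^ q) = (if p = 4 \<and> q = 1 then 4 else 0) - k * y ^ p * z ^ q"
    and van: "\<And>i. i \<in> A \<Longrightarrow>
      (\<Sum>(p, q)\<in>insert (2,0) (insert (2,1) low_exponents). c (p, q) * (u i ^ p * v i ^ q)) = 0"
    and or: "c (2, 1) = 0 \<or> k = 0"
    and j: "j \<in> insert (2,0) (insert (2,1) low_exponents)"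
  shows "c j = 0"
proof -
  define m where "m p q = (\<Sum>i\<in>A. w i * u i ^ p * v i ^ q)" for p q
  have D: "(\<Sum>(p, q)\<in>insert (2,0) (insert (2,1) low_exponents). c (p, q) * m (p + s) (q + t)) = 0" for s t
    unfolding m_def by (rule moment_vanishing_combination) (rule van)
  have m: "m p q = (if p = 1 \<and> q = 3 then 1 else 0)" if "p + q \<le> 4" for p q
    using M[OF that] by (simp add: m_def)
  have m5: "m p q = (if p = 4 \<and> q = 1 then 4 else 0) - k * y ^ p * z ^ q" if "p + q = 5" for p q
    using M5[OF that] by (simp add: m_def)
  have c13: "c (Suc 0, 3) = 0" using D[of 0 0] by (simp add: low_exponents_def m)
  have c12: "c (Suc 0, 2) = 0" using D[of 0 1] by (simp add: low_exponents_def m c13)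
  have c03: "c (0, 3) = 0" using D[of 1 0] by (simp add: low_exponents_def m c13 c12)
  \<comment> \<open>For \<open>k = 0\<close> the moment of u^4 v is 4, so multiplying by u^2
    isolates this coefficient.\<close>
  have c21: "c (2, Suc 0) = 0"
    using or D[of 2 0] by (auto simp: low_exponents_def m m5 c13 c12 c03)
  have c11: "c (Suc 0, Suc 0) = 0" using D[of 0 2] by (simp add: low_exponents_def m c13 c12 c03 c21)
  have c02: "c (0, 2) = 0" using D[of 1 1] by (simp add: low_exponents_def m c13 c12 c03 c11 c21)
  \<comment> \<open>If \<open>c (2, 0)\<close> were nonzero, the moment of u^5 would give
    \<open>k = 0\<close> or \<open>y = 0\<close>; either way the moment of u^4 v is 4, against the
    second equation.\<close>
  have "c (2, 0) * (k * y ^ 5) = 0"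
    using D[of 3 0] by (simp add: low_exponents_def m m5 c13 c12 c03 c11 c21 c02)
  moreover have "c (2, 0) * (4 - k * y ^ 4 * z) = 0"
    using D[of 2 1] by (simp add: low_exponents_def m m5 c13 c12 c03 c11 c21 c02)
  ultimately have c20: "c (2, 0) = 0" by auto
  have eq: "(\<Sum>(p, q)\<in>insert (2,0) (insert (2,1) low_exponents). c (p, q) * (u i ^ p * v i ^ q))
      = (\<Sum>(p, q)\<in>low_exponents. c (p, q) * (u i ^ p * v i ^ q))" for i
    using c20 c21 by (simp add: low_exponents_def)
  have "c j = 0" if "j \<in> low_exponents"
    using low_combination_trivial[OF M van[unfolded eq] that] .
  then show ?thesis using j c20 c21 by auto
qed

section \<open>From a decomposition to its moments\<close>

lemma trinomial_fifth_power:
  fixes a b c x y :: complex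
  shows "(a * x + b * y + c) ^ 5 =
    (\<Sum>p\<le>5. (\<Sum>q\<le>5. of_nat (5 choose p) * of_nat ((5 - p) choose q) *
       (a ^ p * b ^ q * c ^ (5 - p - q)) * y ^ q) * x ^ p)"
proof -
  have inner: "(b * y + c) ^ n = (\<Sum>q\<le>5. of_nat (n choose q) * (b ^ q * c ^ (n - q)) * y ^ q)"
    if "n \<le> 5" for n
  proof -
    have "(b * y + c) ^ n = (\<Sum>q\<le>n. of_nat (n choose q) * (b * y) ^ q * c ^ (n - q))"
      by (rule binomial_ring)
    also have "\<dots> = (\<Sum>q\<le>5. of_nat (n choose q) * (b * y) ^ q * c ^ (n - q))"
      using that by (intro sum.mono_neutral_left) auto
    finally show ?thesis by (simp add: power_mult_distrib mult_ac)
  qed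
  have "(a * x + (b * y + c)) ^ 5 =
      (\<Sum>p\<le>5. of_nat (5 choose p) * (a * x) ^ p * (b * y + c) ^ (5 - p))"
    by (rule binomial_ring)
  also have "\<dots> = (\<Sum>p\<le>5. (\<Sum>q\<le>5. of_nat (5 choose p) * of_nat ((5 - p) choose q) *
       (a ^ p * b ^ q * c ^ (5 - p - q)) * y ^ q) * x ^ p)"
    by (intro sum.cong refl)
      (simp add: inner sum_distrib_left sum_distrib_right power_mult_distrib mult_ac)
  finally show ?thesis by (simp add: add.assoc)
qed

text \<open>Set z = 1 and compare coefficients, first in x and then in y. The multinomial
  coefficients of x y z^3 and y^4 z are 20 and 5, so scaling by 20 gives the values 1 and 4.\<close>

lemma decomposition_moments:
  fixes k :: "nat \<Rightarrow> complex" and l :: "nat \<Rightarrow> complex \<times> complex \<times> complex"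
  assumes dec: "\<And>x y z. x * y * z ^ 3 + y ^ 4 * z = (\<Sum>i<r. k i * lin_form (l i) x y z ^ 5)"
    and pqt: "p + q + t = 5"
  shows "(\<Sum>i<r. 20 * k i * (fst (l i) ^ p * fst (snd (l i)) ^ q * snd (snd (l i)) ^ t))
    = (if p = 1 \<and> q = 1 then 1 else if p = 0 \<and> q = 4 then 4 else 0)"
proof -
  define m where "m p q = (\<Sum>i<r. k i * (fst (l i) ^ p * fst (snd (l i)) ^ q * snd (snd (l i)) ^ (5 - p - q)))"
    for p q
  define g :: "nat \<Rightarrow> nat \<Rightarrow> complex" where
    "g p q = (if p = 1 \<and> q = 1 then 1 else if p = 0 \<and> q = 4 then 1 else 0)" for p q
  define h where "h p q = of_nat (5 choose p) * of_nat ((5 - p) choose q) * m p q" for p q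
  have F: "x * y + y ^ 4 = (\<Sum>p\<le>5. (\<Sum>q\<le>5. g p q * y ^ q) * x ^ p)" for x y
    by (simp add: g_def eval_nat_numeral)
  have "(\<Sum>p\<le>5. (\<Sum>q\<le>5. h p q * y ^ q) * x ^ p)
      = (\<Sum>i<r. k i * lin_form (l i) x y 1 ^ 5)" for x y
  proof -
    have "(\<Sum>i<r. k i * lin_form (l i) x y 1 ^ 5) = (\<Sum>i<r. \<Sum>p\<le>5. \<Sum>q\<le>5.
       k i * (of_nat (5 choose p) * of_nat ((5 - p) choose q) *
       (fst (l i) ^ p * fst (snd (l i)) ^ q * snd (snd (l i)) ^ (5 - p - q)) * y ^ q * x ^ p))"
      by (simp add: lin_form_def trinomial_fifth_power sum_distrib_left sum_distrib_right mult.assoc)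
    also have "\<dots> = (\<Sum>p\<le>5. \<Sum>q\<le>5. \<Sum>i<r.
       k i * (of_nat (5 choose p) * of_nat ((5 - p) choose q) *
       (fst (l i) ^ p * fst (snd (l i)) ^ q * snd (snd (l i)) ^ (5 - p - q)) * y ^ q * x ^ p))"
      by (subst sum.swap) (intro sum.cong refl sum.swap)
    also have "\<dots> = (\<Sum>p\<le>5. (\<Sum>q\<le>5. h p q * y ^ q) * x ^ p)"
      by (simp add: h_def m_def sum_distrib_left sum_distrib_right mult_ac)
    finally show ?thesis by simp
  qed
  with dec[of _ _ 1] F have "(\<Sum>p\<le>5. (\<Sum>q\<le>5. g p q * y ^ q) * x ^ p)
      = (\<Sum>p\<le>5. (\<Sum>q\<le>5. h p q * y ^ q) * x ^ p)" for x y by simp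
  then have "(\<Sum>q\<le>5. g p q * y ^ q) = (\<Sum>q\<le>5. h p q * y ^ q)" if "p \<le> 5" for p y
    using that polyfun_eq_coeffs[of "\<lambda>p. \<Sum>q\<le>5. g p q * y ^ q" 5 "\<lambda>p. \<Sum>q\<le>5. h p q * y ^ q"] by blast
  then have gh: "g p q = h p q"
    using pqt polyfun_eq_coeffs[of "g p" 5 "h p"] by auto
  have t: "t = 5 - p - q" using pqt by simp
  have m: "(\<Sum>i<r. 20 * k i * (fst (l i) ^ p * fst (snd (l i)) ^ q * snd (snd (l i)) ^ t)) = 20 * m p q"
    by (simp add: m_def t sum_distrib_left mult.assoc)
  consider "p = 1" "q = 1" | "p = 0" "q = 4" | "g p q = 0" "\<not> (p = 1 \<and> q = 1)" "\<not> (p = 0 \<and> q = 4)"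
    by (metis g_def)
  then show ?thesis
  proof cases
    case 1
    then show ?thesis using gh unfolding m by (simp add: g_def h_def eval_nat_numeral)
  next
    case 2
    then have "5 * m 0 4 = 1" using gh by (simp add: g_def h_def eval_nat_numeral)
    then show ?thesis using 2 unfolding m by simp
  next
    case 3
    have "(5 choose p) \<noteq> 0" "((5 - p) choose q) \<noteq> 0" using pqt by auto
    then have "m p q = 0" using gh 3 by (simp add: h_def)
    then show ?thesis using 3 unfolding m by simp
  qed
qed

section \<open>Lower bound\<close>

lemma decomposition_length_ge_10:
  assumes "waring_decomposable 5 (\<lambda>x y z. x * y * z ^ 3 + y ^ 4 * z) r"
  shows "10 \<le> r"
proof (rule ccontr)
  assume "\<not> 10 \<le> r"
  then have r: "r \<le> 9" by simp
  from assms obtain k l where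
    dec: "\<And>x y z. x * y * z ^ 3 + y ^ 4 * z = (\<Sum>i<r. k i * lin_form (l i) x y z ^ 5)"
    unfolding waring_decomposable_def by blast
  define a where "a i = fst (l i)" for i
  define b where "b i = fst (snd (l i))" for i
  define c where "c i = snd (snd (l i))" for i
  define A where "A = {i. i < r \<and> a i \<noteq> 0}"
  define B where "B = {i. i < r \<and> a i = 0}"
  define w where "w i = 20 * k i * a i ^ 5" for i
  define u where "u i = b i / a i" for i
  define v where "v i = c i / a i" for i
  have fin: "finite A" "finite B" and AB: "A \<inter> B = {}" "A \<union> B = {..<r}"
    by (auto simp: A_def B_def)
  then have card: "card A + card B = r" by (metis card_Un_disjoint card_lessThan)
  \<comment> \<open>Since \<open>0 ^ 0 = 1\<close>, the points of \<open>B\<close> contribute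
    exactly when p + q = 5.\<close>
  have mom: "(\<Sum>i\<in>A. w i * u i ^ p * v i ^ q) + (\<Sum>i\<in>B. 20 * k i * (0 ^ (5 - p - q) * b i ^ p * c i ^ q))
      = (if p = 1 \<and> q = 3 then 1 else if p = 4 \<and> q = 1 then 4 else 0)" if "p + q \<le> 5" for p q
  proof -
    have "w i * u i ^ p * v i ^ q = 20 * k i * (a i ^ (5 - p - q) * b i ^ p * c i ^ q)" if "i \<in> A" for i
    proof -
      have "a i \<noteq> 0" using that by (simp add: A_def)
      moreover have "a i ^ 5 = a i ^ (5 - p - q) * a i ^ p * a i ^ q"
        using \<open>p + q \<le> 5\<close> by (simp flip: power_add)
      ultimately show ?thesis by (simp add: w_def u_def v_def power_divide)
    qed
    moreover have "20 * k i * (0 ^ (5 - p - q) * b i ^ p * c i ^ q)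
        = 20 * k i * (a i ^ (5 - p - q) * b i ^ p * c i ^ q)" if "i \<in> B" for i
      using that by (simp add: B_def)
    ultimately have "(\<Sum>i\<in>A. w i * u i ^ p * v i ^ q) + (\<Sum>i\<in>B. 20 * k i * (0 ^ (5 - p - q) * b i ^ p * c i ^ q))
      = (\<Sum>i\<in>A. 20 * k i * (a i ^ (5 - p - q) * b i ^ p * c i ^ q))
        + (\<Sum>i\<in>B. 20 * k i * (a i ^ (5 - p - q) * b i ^ p * c i ^ q))"
      by (intro arg_cong2[where f = "(+)"] sum.cong refl)
    also have "\<dots> = (\<Sum>i<r. 20 * k i * (a i ^ (5 - p - q) * b i ^ p * c i ^ q))"
      unfolding AB(2)[symmetric] by (rule sum.union_disjoint[OF fin AB(1), symmetric])
    also have "\<dots> = (if 5 - p - q = 1 \<and> p = 1 then 1 else if 5 - p - q = 0 \<and> p = 4 then 4 else 0)"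
      using decomposition_moments[OF dec, of "5 - p - q" p q] that by (simp add: a_def b_def c_def)
    also have "\<dots> = (if p = 1 \<and> q = 3 then 1 else if p = 4 \<and> q = 1 then 4 else 0)"
      using that by auto
    finally show ?thesis .
  qed
  have M: "(\<Sum>i\<in>A. w i * u i ^ p * v i ^ q) = (if p = 1 \<and> q = 3 then 1 else 0)" if "p + q \<le> 4" for p q
    using mom[of p q] that by (auto simp: power_0_left)
  have M5: "(\<Sum>i\<in>A. w i * u i ^ p * v i ^ q)
      = (if p = 4 \<and> q = 1 then 4 else 0) - (\<Sum>i\<in>B. 20 * k i * (b i ^ p * c i ^ q))" if "p + q = 5" for p q
    using mom[of p q] that by (auto simp: eq_diff_eq)
  have dep: "\<exists>d. (\<forall>j. j \<notin> J \<longrightarrow> d j = 0) \<and> (\<exists>j. d j \<noteq> 0) \<and>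
      (\<forall>i\<in>A. (\<Sum>(p, q)\<in>J. d (p, q) * (u i ^ p * v i ^ q)) = 0)"
    if "finite J" "card A < card J" for J
    using exists_nontrivial_vanishing_combination[OF fin(1) that,
        of "\<lambda>(p, q) i. u i ^ p * v i ^ q"] by (simp add: case_prod_unfold)
  have A8: "8 \<le> card A"
  proof (rule ccontr)
    assume "\<not> 8 \<le> card A"
    then have "finite low_exponents" "card A < card low_exponents" by (simp_all add: low_exponents_def)
    from dep[OF this] obtain d where d: "\<forall>j. j \<notin> low_exponents \<longrightarrow> d j = 0" "\<exists>j. d j \<noteq> 0"
        "\<forall>i\<in>A. (\<Sum>(p, q)\<in>low_exponents. d (p, q) * (u i ^ p * v i ^ q)) = 0"
      by blast
    have "d j = 0" if "j \<in> low_exponents" for j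
      using low_combination_trivial[where A = A and w = w and u = u and v = v and c = d, OF M bspec[OF d(3)] that] .
    then show False using d(1,2) by blast
  qed
  \<comment> \<open>\<open>J\<close> has 10 elements if \<open>B\<close> is empty and 9 if it is a
    singleton, always exceeding \<open>card A\<close>, which is at most 9 or 8 respectively.\<close>
  define J :: "(nat \<times> nat) set" where
    "J = insert (2,0) (if B = {} then insert (2,1) low_exponents else low_exponents)"
  have "card B = 0 \<or> card B = 1" using A8 card r by linarith
  then obtain \<kappa> y z where B: "\<And>p q. (\<Sum>i\<in>B. 20 * k i * (b i ^ p * c i ^ q)) = \<kappa> * y ^ p * z ^ q"
    and \<kappa>: "B = {} \<Longrightarrow> \<kappa> = 0"
  proof
    assume "card B = 0"
    then show thesis using that[of 0] fin by simp
  next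
    assume "card B = 1"
    then obtain i where "B = {i}" by (auto simp: card_1_singleton_iff)
    then show thesis using that[of "20 * k i" "b i" "c i"] by (simp add: mult.assoc)
  qed
  have "card B \<noteq> 0 \<or> B = {}" using fin by simp
  then have card_J: "card A < card J" using card r by (auto simp: J_def low_exponents_def)
  have "finite J" by (simp add: J_def low_exponents_def)
  from dep[OF this card_J] obtain d where d: "\<forall>j. j \<notin> J \<longrightarrow> d j = 0" "\<exists>j. d j \<noteq> 0"
      "\<forall>i\<in>A. (\<Sum>(p, q)\<in>J. d (p, q) * (u i ^ p * v i ^ q)) = 0"
    by blast
  have J: "J \<subseteq> insert (2,0) (insert (2,1) low_exponents)" by (auto simp: J_def)
  have van: "(\<Sum>(p, q)\<in>insert (2,0) (insert (2,1) low_exponents). d (p, q) * (u i ^ p * v i ^ q)) = 0"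
    if "i \<in> A" for i
  proof -
    have "(\<Sum>(p, q)\<in>insert (2,0) (insert (2,1) low_exponents). d (p, q) * (u i ^ p * v i ^ q))
       = (\<Sum>(p, q)\<in>J. d (p, q) * (u i ^ p * v i ^ q))"
      using J d(1) by (intro sum.mono_neutral_right) (auto simp: low_exponents_def)
    then show ?thesis using bspec[OF d(3) that] by simp
  qed
  have "(2, 1) \<notin> J" if "B \<noteq> {}" using that by (simp add: J_def low_exponents_def)
  then have "d (2, 1) = 0 \<or> \<kappa> = 0" using \<kappa> d(1) by blast
  then have "d j = 0" if "j \<in> insert (2,0) (insert (2,1) low_exponents)" for j
    using combination_trivial[where A = A and w = w and u = u and v = v and c = d,
      OF M M5[unfolded B] van _ that] by blast
  then show False using d(1,2) J by blast
qed

section \<open>Upper bound\<close>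

lemma fifth_power_difference:
  fixes s t :: complex
  shows "(s + t) ^ 5 - (s - t) ^ 5 = 10 * s ^ 4 * t + 20 * s ^ 2 * t ^ 3 + 2 * t ^ 5"
  by algebra

lemma decomposable_10:
  "waring_decomposable 5 (\<lambda>x y z. x * y * z ^ 3 + y ^ 4 * z) 10"
proof -
  \<comment> \<open>The slopes 6/5 and 8/5 come from \<open>N^2 z^3 + (2/5) z^5\<close> being apolar to
    \<open>\<omega>^4 - 4 \<omega>^2 + const\<close>, with the constant chosen so that the roots are rational.\<close>
  define k :: "nat \<Rightarrow> complex" where "k = (!)
    [-4 * \<i> / 1344000, 4 * \<i> / 1344000, 3 * \<i> / 1344000, -3 * \<i> / 1344000,
     4 / 1344000, -4 / 1344000, -3 / 1344000, 3 / 1344000, 1 / 10, -1 / 10]"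
  define l :: "nat \<Rightarrow> complex \<times> complex \<times> complex" where "l = (!)
    [(5, -5, 6 * \<i>), (5, -5, -6 * \<i>), (5, -5, 8 * \<i>), (5, -5, -8 * \<i>),
     (5, -15, 6), (5, -15, -6), (5, -15, 8), (5, -15, -8), (0, 1, 1), (0, 1, -1)]"
  have i_powers: "\<i> ^ 3 = - \<i>" "\<i> ^ 5 = \<i>"
    by (simp_all add: eval_nat_numeral)
  have "x * y * z ^ 3 + y ^ 4 * z = (\<Sum>i<10. k i * lin_form (l i) x y z ^ 5)" for x y z
  proof -
    \<comment> \<open>The factor 5 clears the denominators of the slopes; it turns the quarter of a
      square into a hundredth.\<close>
    define P where "P = 5 * (x - y)"
    define N where "N = 5 * (x - 3 * y)"
    define \<Delta> :: "complex \<Rightarrow> complex \<Rightarrow> complex" where "\<Delta> s t = (s + t) ^ 5 - (s - t) ^ 5" for s t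
    have ten: "(\<Sum>i<10. f i) = f 0 + f 1 + f 2 + f 3 + f 4 + f 5 + f 6 + f 7 + f 8 + f 9"
      for f :: "nat \<Rightarrow> complex"
      by (simp add: eval_nat_numeral)
    have lin: "lin_form (l 0) x y z = P + 6 * \<i> * z" "lin_form (l 1) x y z = P - 6 * \<i> * z"
        "lin_form (l 2) x y z = P + 8 * \<i> * z" "lin_form (l 3) x y z = P - 8 * \<i> * z"
        "lin_form (l 4) x y z = N + 6 * z" "lin_form (l 5) x y z = N - 6 * z"
        "lin_form (l 6) x y z = N + 8 * z" "lin_form (l 7) x y z = N - 8 * z"
        "lin_form (l 8) x y z = y + z" "lin_form (l 9) x y z = y - z"
      by (simp_all add: l_def lin_form_def P_def N_def algebra_simps)
    have coeff: "k 0 = -4 * \<i> / 1344000" "k 1 = 4 * \<i> / 1344000" "k 2 = 3 * \<i> / 1344000"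
        "k 3 = -3 * \<i> / 1344000" "k 4 = 4 / 1344000" "k 5 = -4 / 1344000" "k 6 = -3 / 1344000"
        "k 7 = 3 / 1344000" "k 8 = 1 / 10" "k 9 = -1 / 10"
      by (simp_all add: k_def)
    \<comment> \<open>The weights 4 and 3 cancel the terms in P^4 z and N^4 z because 4 * 6 = 3 * 8.
      The cubic terms leave 20 * (3 * 8^3 - 4 * 6^3) = 13440, whence 1344000 after division by 100.
      Replacing z by \<open>\<i> * z\<close> flips the sign of z^3 relative to z^5.\<close>
    have "(\<Sum>i<10. k i * lin_form (l i) x y z ^ 5) =
       (- \<i>) / 1344000 * (4 * \<Delta> P (6 * \<i> * z) - 3 * \<Delta> P (8 * \<i> * z))
       + 1 / 1344000 * (4 * \<Delta> N (6 * z) - 3 * \<Delta> N (8 * z)) + 1 / 10 * \<Delta> y z"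
      unfolding ten lin coeff \<Delta>_def by (simp add: right_diff_distrib)
    also have "(- \<i>) / 1344000 * (4 * \<Delta> P (6 * \<i> * z) - 3 * \<Delta> P (8 * \<i> * z))
        = P ^ 2 * z ^ 3 / 100 - z ^ 5 / 10"
      unfolding \<Delta>_def fifth_power_difference power_mult_distrib i_powers by (simp add: algebra_simps)
    also have "1 / 1344000 * (4 * \<Delta> N (6 * z) - 3 * \<Delta> N (8 * z))
        = - (N ^ 2 * z ^ 3) / 100 - z ^ 5 / 10"
      unfolding \<Delta>_def fifth_power_difference power_mult_distrib by (simp add: algebra_simps)
    also have "1 / 10 * \<Delta> y z = y ^ 4 * z + 2 * y ^ 2 * z ^ 3 + z ^ 5 / 5"
      unfolding \<Delta>_def fifth_power_difference by (simp add: algebra_simps)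
    also have "P ^ 2 * z ^ 3 / 100 - z ^ 5 / 10 + (- (N ^ 2 * z ^ 3) / 100 - z ^ 5 / 10)
        + (y ^ 4 * z + 2 * y ^ 2 * z ^ 3 + z ^ 5 / 5)
      = (P ^ 2 - N ^ 2) / 100 * z ^ 3 + y ^ 4 * z + 2 * y ^ 2 * z ^ 3"
      by (simp add: field_simps)
    also have "P ^ 2 - N ^ 2 = (x * y - 2 * y ^ 2) * 100"
      unfolding P_def N_def by algebra
    also have "(x * y - 2 * y ^ 2) * 100 / 100 = x * y - 2 * y ^ 2"
      by (rule nonzero_mult_div_cancel_right) simp
    finally show ?thesis by (simp add: algebra_simps)
  qed
  then show ?thesis unfolding waring_decomposable_def by blast
qed

theorem mainTheorem12:
  shows "waring_rank 5 (\<lambda>x y z. x * y * z ^ 3 + y ^ 4 * z) = 10"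
  unfolding waring_rank_def
  by (rule Least_equality) (fact decomposable_10, fact decomposition_length_ge_10)

end
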